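(* Let $\mathbf{A}\in\mathbb{R}^{M\times N}$, $\mathbf{y}\in\mathbb{R}^M$, $\mu>0$, and let $\delta>0$ be a constant. Let $(\tau^k)_{k\ge 0}$ be step sizes and let $(\mathbf{x}^k)_{k\ge 0}\subset\mathbb{R}^N$ be the sequence generated by the inexact iterative hard thresholding (IIHT) algorithm with $\mathbf{x}^0=0$ and step sizes $\tau^k$. If $$0<\tau^k\le \frac{1}{\|\mathbf{A}\|_2^2+\delta}\quad\text{for all } k\ge 0,$$ then $\lim_{k\to\infty}\|\mathbf{x}^{k+1}-\mathbf{x}^k\|_2=0$.
   Context: $\|\mathbf{A}\|_2$ denotes the spectral (operator $\ell_2$) norm of the matrix $\mathbf{A}$, and $\|\cdot\|_2$ on vectors is the Euclidean norm. $\mathbf{A}_i\in\mathbb{R}^{M}$ is the $i$-th column of $\mathbf{A}$. For $b\in\mathbb{R}$ and $t>0$, the hard thresholding operator is $\mathrm{hard}(b,t)=0$ if $|b|<t$, and $\mathrm{hard}(b,t)=b$ otherwise (i.e. if $|b|\ge t$). The IIHT algorithm: given $\mathbf{A}\in\mathbb{R}^{M\times N}$, $\mathbf{y}\in\mathbb{R}^M$, a parameter $\mu>0$ and positive step sizes $\tau^k$ (where $\tau^k$ may depend on $\mathbf{x}^k$), start from $\mathbf{x}^0=0\in\mathbb{R}^N$ and for $k\ge 0$ and $i=1,\dots,N$ set $$x_i^{k+1}=\mathrm{hard}\left(x_i^k+\tau^k\mathbf{A}_i^T(\mathbf{y}-\mathbf{A}\mathbf{x}^k),\ \sqrt{2\tau^k/\mu}\right).$$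 *)

theory Defs
  imports "HOL-Analysis.Analysis"
begin

definition hard :: "real \<Rightarrow> real \<Rightarrow> real" where
  "hard b t = (if \<bar>b\<bar> < t then 0 else b)"

text \<open>The operator norm induced by the Euclidean norms on both spaces.\<close>

definition spectral_norm :: "real ^ 'n ^ 'm \<Rightarrow> real" where
  "spectral_norm A = onorm ((*v) A)"

text \<open>
  The step sizes may be chosen adaptively, depending on the current iterate, so the algorithm
  is rendered as a relation between a sequence of step sizes and a sequence of iterates.
\<close>

definition iiht_sequence ::
  "real ^ 'n ^ 'm \<Rightarrow> real ^ 'm \<Rightarrow> real \<Rightarrow> (nat \<Rightarrow> real) \<Rightarrow> (nat \<Rightarrow> real ^ 'n) \<Rightarrow> bool" where
  "iiht_sequence A y \<mu> \<tau> x \<longleftrightarrow>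
     x 0 = 0 \<and>
     (\<forall>k i. x (Suc k) $ i =
        hard (x k $ i + \<tau> k * (column i A \<bullet> (y - A *v x k))) (sqrt (2 * \<tau> k / \<mu>)))"

end

theory Submission
  imports Defs
begin

text \<open>
  The thresholded value \<open>hard b (sqrt (2 * c))\<close> minimises \<open>(z - b)\<^sup>2 / 2 + c * [z \<noteq> 0]\<close>. Comparing it
  with the previous coordinate and summing shows that every step decreases the penalised residual
  \<open>\<parallel>y - A x\<parallel>\<^sup>2 / 2 + \<parallel>x\<parallel>\<^sub>0 / \<mu>\<close> by at least \<open>\<delta> / 2\<close> times the squared length of the step. The
  residual is nonnegative, so it converges along the iterates, and the steps tend to zero.
\<close>

text \<open>On nonzero \<open>z\<close> the penalty is the constant \<open>c\<close>, so no nonzero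
  candidate beats \<open>z = b\<close> at cost at most \<open>c\<close>, while \<open>z = 0\<close>
  costs \<open>b\<^sup>2 / 2\<close>. The threshold \<open>sqrt (2 * c)\<close> is where these two
  costs agree, so thresholding picks the cheaper one.\<close>

lemma hard_minimises:
  fixes b c z :: real
  assumes "c \<ge> 0"
  shows "(hard b (sqrt (2 * c)) - b)\<^sup>2 / 2 + c * of_bool (hard b (sqrt (2 * c)) \<noteq> 0)
    \<le> (z - b)\<^sup>2 / 2 + c * of_bool (z \<noteq> 0)"
proof (cases "\<bar>b\<bar> < sqrt (2 * c)")
  case True
  then have "\<bar>b\<bar>\<^sup>2 \<le> (sqrt (2 * c))\<^sup>2"
    by (intro power_mono) auto
  then have "b\<^sup>2 \<le> 2 * c" using assms by simp
  then show ?thesis using True assms by (cases "z = 0") (auto simp: hard_def add_increasing)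
next
  case False
  then have "(sqrt (2 * c))\<^sup>2 \<le> \<bar>b\<bar>\<^sup>2"
    using assms by (intro power_mono) auto
  then have "2 * c \<le> b\<^sup>2" using assms by simp
  then show ?thesis using False assms by (cases "z = 0") (auto simp: hard_def)
qed

text \<open>Splits the linear term of the residual into the coordinatewise gradient terms used by
  the algorithm.\<close>

lemma inner_matrix_vector_mult_columns:
  fixes A :: "real ^ 'n ^ 'm"
  shows "r \<bullet> (A *v d) = (\<Sum>i\<in>UNIV. d $ i * (column i A \<bullet> r))"
  by (simp add: matrix_mult_sum inner_sum_right scalar_mult_eq_scaleR inner_commute)

lemma norm_matrix_vector_mult_le_spectral_norm:
  fixes A :: "real ^ 'n ^ 'm"
  shows "norm (A *v d) \<le> spectral_norm A * norm d"
  unfolding spectral_norm_def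
  by (rule onorm) (rule matrix_vector_mul_bounded_linear)

definition iiht_objective :: "real ^ 'n ^ 'm \<Rightarrow> real ^ 'm \<Rightarrow> real \<Rightarrow> real ^ 'n \<Rightarrow> real" where
  "iiht_objective A y \<mu> x =
     (norm (y - A *v x))\<^sup>2 / 2 + (\<Sum>i\<in>UNIV. of_bool (x $ i \<noteq> 0)) / \<mu>"

lemma iiht_objective_nonneg: "\<mu> > 0 \<Longrightarrow> 0 \<le> iiht_objective A y \<mu> x"
  by (auto simp: iiht_objective_def intro!: add_nonneg_nonneg divide_nonneg_pos sum_nonneg)

text \<open>Thresholding minimises a separable surrogate in which the curvature of the residual is
  replaced by \<open>1 / t\<close>. The step size bound makes \<open>1 / t\<close> exceed the true
  curvature by at least \<open>\<delta>\<close>, and this surplus is the guaranteed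
  decrease.\<close>

lemma iiht_step_decrease:
  fixes A :: "real ^ 'n ^ 'm" and x z :: "real ^ 'n"
  assumes "\<mu> > 0" "\<delta> > 0" "0 < t" and t: "t \<le> 1 / ((spectral_norm A)\<^sup>2 + \<delta>)"
    and z: "\<And>i. z $ i = hard (x $ i + t * (column i A \<bullet> (y - A *v x))) (sqrt (2 * t / \<mu>))"
  shows "\<delta> / 2 * (norm (z - x))\<^sup>2 \<le> iiht_objective A y \<mu> x - iiht_objective A y \<mu> z"
proof -
  define r where "r = y - A *v x"
  define d where "d = z - x"
  define Z X where "Z = (\<Sum>i\<in>UNIV. of_bool (z $ i \<noteq> 0) :: real)"
    and "X = (\<Sum>i\<in>UNIV. of_bool (x $ i \<noteq> 0) :: real)"
  \<comment> \<open>The previous coordinate \<open>x $ i\<close> serves as competitor, with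
    \<open>c = t / \<mu>\<close> to match the threshold. After expansion the squared gradient terms
    on both sides cancel.\<close>
  have coord: "(d $ i)\<^sup>2 / 2 - t * (d $ i * (column i A \<bullet> r))
      \<le> t / \<mu> * (of_bool (x $ i \<noteq> 0) - of_bool (z $ i \<noteq> 0))" for i
  proof -
    have "(z $ i - (x $ i + t * (column i A \<bullet> r)))\<^sup>2 / 2 + t / \<mu> * of_bool (z $ i \<noteq> 0)
        \<le> (x $ i - (x $ i + t * (column i A \<bullet> r)))\<^sup>2 / 2 + t / \<mu> * of_bool (x $ i \<noteq> 0)"
      using hard_minimises[of "t / \<mu>" "x $ i + t * (column i A \<bullet> r)" "x $ i"] assms(1,3)
      by (simp add: z r_def)
    then show ?thesis
      by (simp add: d_def power2_eq_square algebra_simps add_divide_distrib diff_divide_distrib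
          split del: split_of_bool)
  qed
  have norm_d: "(norm d)\<^sup>2 = (\<Sum>i\<in>UNIV. (d $ i)\<^sup>2)"
    unfolding power2_norm_eq_inner by (simp add: inner_vec_def power2_eq_square)
  have "(norm d)\<^sup>2 / 2 - t * (r \<bullet> (A *v d)) \<le> t / \<mu> * (X - Z)"
  proof -
    have "(\<Sum>i\<in>UNIV. (d $ i)\<^sup>2 / 2 - t * (d $ i * (column i A \<bullet> r)))
        \<le> (\<Sum>i\<in>UNIV. t / \<mu> * (of_bool (x $ i \<noteq> 0) - of_bool (z $ i \<noteq> 0)))"
      by (intro sum_mono coord)
    then show ?thesis
      unfolding norm_d inner_matrix_vector_mult_columns X_def Z_def
      by (simp only: sum_subtractf sum_distrib_left[symmetric] sum_divide_distrib[symmetric])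
  qed
  then have "t * ((norm d)\<^sup>2 / (2 * t)) \<le> t * (r \<bullet> (A *v d) + (X - Z) / \<mu>)"
    using \<open>0 < t\<close> by (simp add: algebra_simps)
  then have step: "(norm d)\<^sup>2 / (2 * t) \<le> r \<bullet> (A *v d) + (X - Z) / \<mu>"
    using \<open>0 < t\<close> by (simp only: mult_le_cancel_left_pos)
  \<comment> \<open>Since \<open>\<delta> > 0\<close>, the denominator is positive even for
    \<open>A = 0\<close>, so the bound on \<open>t\<close> can be inverted.\<close>
  have "(spectral_norm A)\<^sup>2 + \<delta> \<le> 1 / t"
    using t \<open>0 < t\<close> add_nonneg_pos[OF zero_le_power2[of "spectral_norm A"] \<open>\<delta> > 0\<close>]
    by (simp add: pos_le_divide_eq mult.commute)
  then have "((spectral_norm A)\<^sup>2 + \<delta>) * (norm d)\<^sup>2 \<le> 1 / t * (norm d)\<^sup>2"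
    by (intro mult_right_mono) auto
  moreover have "(norm (A *v d))\<^sup>2 \<le> (spectral_norm A)\<^sup>2 * (norm d)\<^sup>2"
    using power_mono[OF norm_matrix_vector_mult_le_spectral_norm[of A d], of 2]
    by (simp add: power_mult_distrib)
  ultimately have curvature: "\<delta> / 2 * (norm d)\<^sup>2 + (norm (A *v d))\<^sup>2 / 2 \<le> (norm d)\<^sup>2 / (2 * t)"
    by (simp add: algebra_simps)
  \<comment> \<open>The residual is quadratic, so its expansion around \<open>x\<close> is exact,
    and its linear term is the one bounded in \<open>step\<close>.\<close>
  have "y - A *v z = r - A *v d"
    by (simp add: r_def d_def matrix_vector_mult_diff_distrib)
  then have "(norm (y - A *v z))\<^sup>2 = (norm r)\<^sup>2 - 2 * (r \<bullet> (A *v d)) + (norm (A *v d))\<^sup>2"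
    by (simp add: power2_norm_eq_inner inner_diff_left inner_diff_right inner_commute)
  then have "iiht_objective A y \<mu> x - iiht_objective A y \<mu> z
      = r \<bullet> (A *v d) - (norm (A *v d))\<^sup>2 / 2 + (X - Z) / \<mu>"
    by (simp add: iiht_objective_def r_def X_def Z_def diff_divide_distrib add_divide_distrib)
  with step curvature show ?thesis unfolding d_def by linarith
qed

theorem theorem3:
  fixes A :: "real ^ 'n ^ 'm" and y :: "real ^ 'm"
    and \<mu> \<delta> :: real
    and \<tau> :: "nat \<Rightarrow> real" and x :: "nat \<Rightarrow> real ^ 'n"
  assumes "\<mu> > 0" and "\<delta> > 0"
    and "iiht_sequence A y \<mu> \<tau> x"
    and "\<And>k. 0 < \<tau> k \<and> \<tau> k \<le> 1 / ((spectral_norm A)\<^sup>2 + \<delta>)"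
  shows "(\<lambda>k. norm (x (Suc k) - x k)) \<longlonglongrightarrow> 0"
proof -
  define F where "F k = iiht_objective A y \<mu> (x k)" for k
  \<comment> \<open>The factor \<open>\<delta> / 2\<close> does not involve \<open>\<tau> k\<close>,
    so the estimate is uniform although step sizes may vary.\<close>
  have decrease: "\<delta> / 2 * (norm (x (Suc k) - x k))\<^sup>2 \<le> F k - F (Suc k)" for k
    unfolding F_def using assms
    by (intro iiht_step_decrease[where t = "\<tau> k"]) (auto simp: iiht_sequence_def)
  have "0 \<le> F k - F (Suc k)" for k
    using decrease[of k] \<open>\<delta> > 0\<close> by (smt (verit) mult_nonneg_nonneg half_gt_zero zero_le_power2)
  then have "decseq F"
    by (intro decseq_SucI) simp
  moreover have "\<And>k. 0 \<le> F k"
    using \<open>\<mu> > 0\<close> by (simp add: F_def iiht_objective_nonneg)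
  ultimately obtain L where "F \<longlonglongrightarrow> L"
    using decseq_convergent by blast
  \<comment> \<open>The shifted sequence has the same limit, so the consecutive drops of
    \<open>F\<close> vanish; they dominate the squared steps.\<close>
  then have "(\<lambda>k. F k - F (Suc k)) \<longlonglongrightarrow> L - L"
    by (intro tendsto_diff LIMSEQ_Suc)
  then have bound: "(\<lambda>k. 2 / \<delta> * (F k - F (Suc k))) \<longlonglongrightarrow> 0"
    by (intro tendsto_mult_right_zero) simp
  have "(\<lambda>k. (norm (x (Suc k) - x k))\<^sup>2) \<longlonglongrightarrow> 0"
  proof (rule tendsto_sandwich[OF _ _ tendsto_const bound])
    show "\<forall>\<^sub>F k in sequentially. (norm (x (Suc k) - x k))\<^sup>2 \<le> 2 / \<delta> * (F k - F (Suc k))"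
      using decrease \<open>\<delta> > 0\<close> by (intro always_eventually allI) (simp add: field_simps)
  qed simp
  then show ?thesis
    using tendsto_real_sqrt[of "\<lambda>k. (norm (x (Suc k) - x k))\<^sup>2" 0] by simp
qed

end
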